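(* Let $\Pi=(\Lambda,X,f)$ be an instance of a linear-$p$-parametric minimization problem satisfying the standing assumptions of the context, and let $W$ be the homogenization of $\Lambda$ and $\Pi^W$ the parametric homogenization of $\Pi$. Let $\varepsilon\geq0$ and let $S\subseteq X_{\mathrm{pol}}$ be a $(1+\varepsilon)$-approximation set for $\Pi$. Then, for each $w\in W$, the problem $\Pi^W(w)$ is bounded and $(1+\varepsilon)$-approximated by at least one solution $x$ from $S$.
   Context: **Problem.** Fix $p\in\mathbb{N}_{>0}$. An instance of a linear-$p$-parametric minimization problem is $\Pi=(\Lambda,X,f)$, where $\Lambda=\{\lambda\in\mathbb{R}^p: Q\lambda\geq d\}$ with $m\in\mathbb{N}_{>0}$, $Q\in\mathbb{Q}^{m\times p}$, $d\in\mathbb{Q}^m$; $X$ is a set (of feasible solutions); and $f=(f_1,\ldots,f_{p+1})^{\mathsf T}:X\to\mathbb{R}^{p+1}$. $\langle\cdot\rangle$ denotes binary encoding length. Let $F_\lambda(x)=\sum_{i=1}^p\lambda_i f_i(x)+f_{p+1}(x)$; for $\lambda\in\Lambda$, $\Pi(\lambda)$ is the problem $\min_{x\in X}F_\lambda(x)$ with optimal value $F^*(\lambda)$. A $(1+\varepsilon)$-approximation set for $\Pi$ is a set $S\subseteq X$ such that for every $\lambda\in\Lambda$ there is $x\in S$ with $F_\lambda(x)\leq(1+\varepsilon)F^*(\lambda)$; such an $x$ is said to $(1+\varepsilon)$-approximate $\Pi(\lambda)$. **Standing assumptions.** (a) $f$ is polynomial-time computable, every $\Pi(\lambda)$, $\lambda\in\Lambda$,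 is bounded, and every $\Pi(\lambda)$ has an optimal solution of encoding length bounded by a fixed polynomial in $\langle\Pi\rangle$. $X_{\mathrm{pol}}\subseteq X$ denotes the (finite) set of all solutions with encoding length bounded by such a fixed polynomial in $\langle\Pi\rangle$. (b) $p$ is a constant, $\Lambda$ is $p$-dimensional (not necessarily bounded), and $Q\lambda\ge d$ contains no redundant inequalities. (c) If $\varepsilon>0$, then $F_\lambda(x)\geq0$ for all $\lambda\in\Lambda$, $x\in X$. **Homogenization.** The homogenization of $\Lambda$ is the polyhedral cone $W=\{(\lambda,\xi)\in\mathbb{R}^{p+1}:Q\lambda\geq\xi d,\ \xi\geq0\}$. The parametric homogenization of $\Pi$ is the family $\Pi^W=\{\min_{x\in X}w^{\mathsf T}f(x)\}_{w\in W}$; for fixed $w\in W$, $\Pi^W(w)$ denotes the problem $\min_{x\in X}w^{\mathsf T}f(x)$. A solution $x$ $(1+\varepsilon)$-approximates $\Pi^W(w)$ if $w^{\mathsf T}f(x)\leq(1+\varepsilon)\min_{x'\in X}w^{\mathsf T}f(x')$. *)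

theory Defs
  imports "HOL-Analysis.Analysis" "HOL-Computational_Algebra.Polynomial"
begin

section \<open>Deterministic Turing machines and polynomial time\<close>

text \<open>
  One-tape machines with a two-way infinite tape. State 0 is initial and state 1 is the only
  halting state. Symbol 0 is the blank, 1 and 2 are the bits, 3 is a separator; a machine may use
  further symbols. Only the values of \<open>trans\<close> on the finite sets of states and symbols matter.
\<close>

record tm =
  tm_states :: nat
  tm_symbols :: nat
  trans :: "nat \<Rightarrow> nat \<Rightarrow> nat \<times> nat \<times> int"

definition wf_tm :: "tm \<Rightarrow> bool" where
  "wf_tm M \<longleftrightarrow> 2 \<le> tm_states M \<and> 4 \<le> tm_symbols M \<and>
     (\<forall>s < tm_states M. \<forall>a < tm_symbols M. case trans M s a of (s', a', mv) \<Rightarrow>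
        s' < tm_states M \<and> a' < tm_symbols M \<and> mv \<in> {-1, 0, 1})"

fun tm_step :: "tm \<Rightarrow> nat \<times> (int \<Rightarrow> nat) \<times> int \<Rightarrow> nat \<times> (int \<Rightarrow> nat) \<times> int" where
  "tm_step M (s, tape, h) =
     (if s = 1 then (s, tape, h)
      else case trans M s (tape h) of (s', a', mv) \<Rightarrow> (s', tape(h := a'), h + mv))"

definition init_tape :: "nat list \<Rightarrow> int \<Rightarrow> nat" where
  "init_tape u i = (if 0 \<le> i \<and> nat i < length u then u ! nat i else 0)"

definition bit_sym :: "bool \<Rightarrow> nat" where
  "bit_sym b = (if b then 2 else 1)"

text \<open>The output is the bit string that starts at the final head position and is ended by a
  blank.\<close>

definition tm_outputs_within :: "tm \<Rightarrow> nat list \<Rightarrow> bool list \<Rightarrow> nat \<Rightarrow> bool" where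
  "tm_outputs_within M u v n \<longleftrightarrow>
     (\<exists>k\<le>n. \<exists>tape h. (tm_step M ^^ k) (0, init_tape u, 0) = (1, tape, h) \<and>
        (\<forall>i < length v. tape (h + int i) = bit_sym (v ! i)) \<and> tape (h + int (length v)) = 0)"

text \<open>Sign bit followed by the absolute value in binary, least significant bit first.\<close>

fun int_of_bits :: "bool list \<Rightarrow> int" where
  "int_of_bits [] = 0"
| "int_of_bits (s # bs) = (if s then - 1 else 1) * horner_sum of_bool 2 bs"


section \<open>Linear parametric minimization problems\<close>

text \<open>
  The number \<open>p\<close> of parameters is \<open>CARD('p)\<close>, and \<open>\<real>\<^sup>p\<^sup>+\<^sup>1\<close> is rendered as \<open>real^'p \<times> real\<close>, whose
  second component is the coordinate of index \<open>p + 1\<close>; the inner product of this product space is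
  the standard one. The rows of the matrix \<open>Q\<close> are kept in a list, so that the number \<open>m\<close> of
  inequalities may differ between the instances of a problem. The value of \<open>objective\<close> matters on
  \<open>feasible\<close> only.
\<close>

record ('p::finite, 'x) lp_instance =
  Qrows :: "(rat^'p) list"
  rhs :: "rat list"
  feasible :: "'x set"
  objective :: "'x \<Rightarrow> (real^'p) \<times> real"

text \<open>
  A problem is a collection of instances together with binary encodings of instances and
  solutions. Solutions without a finite encoding (for instance irrational points of a polytope) are
  allowed; \<open>sol_code\<close> is \<open>None\<close> on them.
\<close>

record ('p::finite, 'x) lp_problem =
  instances :: "('p, 'x) lp_instance set"
  inst_code :: "('p, 'x) lp_instance \<Rightarrow> bool list"
  sol_code :: "'x \<Rightarrow> bool list option"

definition linear_parametric_problem :: "('p::finite, 'x) lp_problem \<Rightarrow> bool" where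
  "linear_parametric_problem \<P> \<longleftrightarrow>
     inj_on (inst_code \<P>) (instances \<P>) \<and>
     (\<forall>\<I> \<in> instances \<P>.
        0 < length (Qrows \<I>) \<and> length (rhs \<I>) = length (Qrows \<I>) \<and>
        inj_on (sol_code \<P>) (feasible \<I> \<inter> dom (sol_code \<P>)))"

definition row_prod :: "rat^'p \<Rightarrow> real^'p \<Rightarrow> real" where
  "row_prod a l = (\<Sum>j\<in>UNIV. of_rat (a $ j) * l $ j)"

definition solution_set :: "('p::finite, 'x) lp_instance \<Rightarrow> nat set \<Rightarrow> (real^'p) set" where
  "solution_set \<I> J = {l. \<forall>i\<in>J. row_prod (Qrows \<I> ! i) l \<ge> of_rat (rhs \<I> ! i)}"

definition param_set :: "('p::finite, 'x) lp_instance \<Rightarrow> (real^'p) set" where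
  "param_set \<I> = solution_set \<I> {..<length (Qrows \<I>)}"

definition no_redundant_inequalities :: "('p::finite, 'x) lp_instance \<Rightarrow> bool" where
  "no_redundant_inequalities \<I> \<longleftrightarrow>
     (\<forall>i < length (Qrows \<I>). solution_set \<I> ({..<length (Qrows \<I>)} - {i}) \<noteq> param_set \<I>)"

definition F :: "('p::finite, 'x) lp_instance \<Rightarrow> real^'p \<Rightarrow> 'x \<Rightarrow> real" where
  "F \<I> l x = (\<Sum>i\<in>UNIV. l $ i * fst (objective \<I> x) $ i) + snd (objective \<I> x)"

text \<open>In the following three notions, the pair \<open>X\<close>, \<open>c\<close> stands for the minimization of \<open>c\<close> over
  \<open>X\<close>. The existence of the minimum is part of \<open>approximates\<close>.\<close>

definition bounded_problem :: "'x set \<Rightarrow> ('x \<Rightarrow> real) \<Rightarrow> bool" where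
  "bounded_problem X c \<longleftrightarrow> bdd_below (c ` X)"

definition optimal_solution :: "'x set \<Rightarrow> ('x \<Rightarrow> real) \<Rightarrow> 'x \<Rightarrow> bool" where
  "optimal_solution X c x \<longleftrightarrow> is_arg_min c (\<lambda>x. x \<in> X) x"

definition approximates :: "real \<Rightarrow> 'x set \<Rightarrow> ('x \<Rightarrow> real) \<Rightarrow> 'x \<Rightarrow> bool" where
  "approximates \<epsilon> X c x \<longleftrightarrow>
     x \<in> X \<and> (\<exists>x'. optimal_solution X c x' \<and> c x \<le> (1 + \<epsilon>) * c x')"

definition approximation_set :: "real \<Rightarrow> ('p::finite, 'x) lp_instance \<Rightarrow> 'x set \<Rightarrow> bool" where
  "approximation_set \<epsilon> \<I> S \<longleftrightarrow>
     S \<subseteq> feasible \<I> \<and> (\<forall>l \<in> param_set \<I>. \<exists>x\<in>S. approximates \<epsilon> (feasible \<I>) (F \<I> l) x)"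


section \<open>Standing assumptions\<close>

definition inst_length :: "('p::finite, 'x) lp_problem \<Rightarrow> ('p, 'x) lp_instance \<Rightarrow> nat" where
  "inst_length \<P> \<I> = length (inst_code \<P> \<I>)"

text \<open>
  Polynomial-time computability of a real-valued function of an instance and a feasible solution:
  given the two codes and \<open>k\<close> in unary, an integer multiple of \<open>2\<^sup>-\<^sup>k\<close> within distance \<open>2\<^sup>-\<^sup>k\<close> of the
  value is computed in time polynomial in the input length. For rational values this is implied by
  the exact computation of numerator and denominator in polynomial time.
\<close>

definition polytime_computable ::
  "('p::finite, 'x) lp_problem \<Rightarrow> (('p, 'x) lp_instance \<Rightarrow> 'x \<Rightarrow> real) \<Rightarrow> bool" where
  "polytime_computable \<P> g \<longleftrightarrow>
     (\<exists>M (t :: nat poly). wf_tm M \<and>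
        (\<forall>\<I> \<in> instances \<P>. \<forall>x \<in> feasible \<I>. \<forall>c. sol_code \<P> x = Some c \<longrightarrow> (\<forall>k. \<exists>v.
           tm_outputs_within M
             (map bit_sym (inst_code \<P> \<I>) @ [3] @ map bit_sym c @ [3] @ replicate k (bit_sym True))
             v (poly t (inst_length \<P> \<I> + length c + k)) \<and>
           \<bar>g \<I> x - of_int (int_of_bits v) / 2 ^ k\<bar> \<le> 1 / 2 ^ k)))"

definition X_pol ::
  "('p::finite, 'x) lp_problem \<Rightarrow> nat poly \<Rightarrow> ('p, 'x) lp_instance \<Rightarrow> 'x set" where
  "X_pol \<P> q \<I> =
     {x \<in> feasible \<I>. \<exists>c. sol_code \<P> x = Some c \<and> length c \<le> poly q (inst_length \<P> \<I>)}"

text \<open>Since \<open>p\<close> is constant, \<open>f\<close> is polynomial-time computable if and only if its components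
  are. The polynomial \<open>q\<close> does not depend on the instance.\<close>

definition assumption_a :: "('p::finite, 'x) lp_problem \<Rightarrow> nat poly \<Rightarrow> bool" where
  "assumption_a \<P> q \<longleftrightarrow>
     (\<forall>i. polytime_computable \<P> (\<lambda>\<I> x. fst (objective \<I> x) $ i)) \<and>
     polytime_computable \<P> (\<lambda>\<I> x. snd (objective \<I> x)) \<and>
     (\<forall>\<I> \<in> instances \<P>. \<forall>l \<in> param_set \<I>.
        bounded_problem (feasible \<I>) (F \<I> l) \<and>
        (\<exists>x \<in> X_pol \<P> q \<I>. optimal_solution (feasible \<I>) (F \<I> l) x))"

definition assumption_b :: "('p::finite, 'x) lp_instance \<Rightarrow> bool" where
  "assumption_b \<I> \<longleftrightarrow> aff_dim (param_set \<I>) = int CARD('p) \<and> no_redundant_inequalities \<I>"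

definition assumption_c :: "real \<Rightarrow> ('p::finite, 'x) lp_instance \<Rightarrow> bool" where
  "assumption_c \<epsilon> \<I> \<longleftrightarrow>
     (\<epsilon> > 0 \<longrightarrow> (\<forall>l \<in> param_set \<I>. \<forall>x \<in> feasible \<I>. F \<I> l x \<ge> 0))"


section \<open>Homogenization\<close>

definition homogenization :: "('p::finite, 'x) lp_instance \<Rightarrow> ((real^'p) \<times> real) set" where
  "homogenization \<I> =
     {(l, \<xi>). (\<forall>i < length (Qrows \<I>). row_prod (Qrows \<I> ! i) l \<ge> \<xi> * of_rat (rhs \<I> ! i)) \<and> \<xi> \<ge> 0}"

definition F_hom :: "('p::finite, 'x) lp_instance \<Rightarrow> (real^'p) \<times> real \<Rightarrow> 'x \<Rightarrow> real" where
  "F_hom \<I> w x = w \<bullet> objective \<I> x"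

end

theory Submission
  imports Defs
begin

text \<open>
  Intersecting the cone \<open>W\<close> with the hyperplane \<open>\<xi> = 1\<close> gives the parameter set \<open>\<Lambda>\<close>, and
  the cost \<open>w \<bullet> f(x)\<close> is linear in \<open>w\<close>. So for \<open>w = (l, \<xi>)\<close> with \<open>\<xi> > 0\<close> the problem at \<open>w\<close> is the
  problem at \<open>l / \<xi> \<in> \<Lambda>\<close> with all costs multiplied by \<open>\<xi>\<close>, and optimal and approximate solutions
  are the same for both (\<open>hom_approximated_interior\<close>).

  The face \<open>\<xi> = 0\<close>, which describes the directions in which \<open>\<Lambda>\<close> is unbounded, is reached by a
  limit: for \<open>l\<^sub>0 \<in> \<Lambda>\<close> the points \<open>w + (l\<^sub>0, 1) / (n + 1)\<close> lie in the convex cone \<open>W\<close>, have positive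
  last component and tend to \<open>w\<close>. In general, nothing can be said about optimal solutions in a
  limit of problems, but here the optimal solutions and the approximating ones can all be taken
  from \<open>X\<^sub>p\<^sub>o\<^sub>l\<close>, which is finite because only finitely many codes respect the length
  bound. By the pigeonhole principle, one pair of an optimal and an approximating solution serves
  infinitely many \<open>n\<close>, and its defining inequalities survive the limit
  (\<open>approximates_limit\<close>). In particular an optimal solution exists at \<open>w\<close>, which is why the problem
  at \<open>w\<close> is bounded.
\<close>

lemma finite_X_pol:
  assumes "linear_parametric_problem \<P>" "\<I> \<in> instances \<P>"
  shows "finite (X_pol \<P> q \<I>)"
proof (rule finite_imageD)
  have "sol_code \<P> ` X_pol \<P> q \<I> \<subseteq>
      Some ` {c. set c \<subseteq> UNIV \<and> length c \<le> poly q (inst_length \<P> \<I>)}"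
    by (auto simp: X_pol_def)
  then show "finite (sol_code \<P> ` X_pol \<P> q \<I>)"
    by (rule finite_subset) (intro finite_imageI finite_lists_length_le finite)
  have "inj_on (sol_code \<P>) (feasible \<I> \<inter> dom (sol_code \<P>))"
    using assms by (auto simp: linear_parametric_problem_def)
  then show "inj_on (sol_code \<P>) (X_pol \<P> q \<I>)"
    by (rule inj_on_subset) (auto simp: X_pol_def)
qed

lemma optimal_solution_iff:
  "optimal_solution X c x \<longleftrightarrow> x \<in> X \<and> (\<forall>y\<in>X. c x \<le> c y)"
  by (auto simp: optimal_solution_def is_arg_min_linorder)

lemma optimal_solution_bounded: "optimal_solution X c x \<Longrightarrow> bounded_problem X c"
  by (auto simp: optimal_solution_iff bounded_problem_def bdd_below_def)

lemma optimal_solution_scale: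
  assumes "0 < r"
  shows "optimal_solution X (\<lambda>x. r * c x) x \<longleftrightarrow> optimal_solution X c x"
  using assms by (simp add: optimal_solution_iff)

lemma approximates_scale:
  assumes "0 < r"
  shows "approximates \<epsilon> X (\<lambda>x. r * c x) x \<longleftrightarrow> approximates \<epsilon> X c x"
  using assms by (simp add: approximates_def optimal_solution_scale mult.left_commute)

text \<open>
  Finiteness of \<open>S\<close> and \<open>T\<close> allows an approximating solution and an optimal one to be kept fixed
  along a subsequence; pointwise convergence of the costs then preserves the inequalities that
  relate these two solutions to each other and to every element of \<open>X\<close>.
\<close>

lemma approximates_limit:
  fixes c :: "nat \<Rightarrow> 'x \<Rightarrow> real"
  assumes lim: "\<And>x. x \<in> X \<Longrightarrow> (\<lambda>n. c n x) \<longlonglongrightarrow> c' x"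
    and fin: "finite S" "finite T"
    and opt: "\<And>n. \<exists>x\<in>T. optimal_solution X (c n) x"
    and appr: "\<And>n. \<exists>x\<in>S. approximates \<epsilon> X (c n) x"
  shows "(\<exists>x\<in>T. optimal_solution X c' x) \<and> (\<exists>x\<in>S. approximates \<epsilon> X c' x)"
proof -
  obtain t where t: "\<And>n. t n \<in> T" "\<And>n. optimal_solution X (c n) (t n)"
    using opt by metis
  obtain s where s: "\<And>n. s n \<in> S" "\<And>n. approximates \<epsilon> X (c n) (s n)"
    using appr by metis
  have "finite (range (\<lambda>n. (s n, t n)))"
    by (rule finite_subset[of _ "S \<times> T"]) (use s t fin in auto)
  then have "\<exists>m\<in>UNIV. infinite {n \<in> UNIV. (s n, t n) = (s m, t m)}"
    by (rule pigeonhole_infinite[OF infinite_UNIV_nat])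
  then obtain m where "infinite {n \<in> UNIV. (s n, t n) = (s m, t m)}"
    by blast
  then obtain r :: "nat \<Rightarrow> nat" where r: "strict_mono r" "\<And>k. (s (r k), t (r k)) = (s m, t m)"
    using infinite_enumerate by blast
  have lim_r: "(\<lambda>k. c (r k) x) \<longlonglongrightarrow> c' x" if "x \<in> X" for x
    using LIMSEQ_subseq_LIMSEQ[OF lim[OF that] r(1)] by (simp add: o_def)
  have X: "s m \<in> X" "t m \<in> X"
    using s(2) t(2) by (auto simp: approximates_def optimal_solution_iff)
  have t_min: "c (r k) (t m) \<le> c (r k) y" if "y \<in> X" for k y
    using t(2)[of "r k"] r(2)[of k] that by (auto simp: optimal_solution_iff)
  \<comment> \<open>The optimal solution that witnesses the approximation may depend on \<open>k\<close>, but it has the same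
    cost as the fixed one.\<close>
  have s_appr: "c (r k) (s m) \<le> (1 + \<epsilon>) * c (r k) (t m)" for k
  proof -
    obtain x where x: "optimal_solution X (c (r k)) x" "c (r k) (s m) \<le> (1 + \<epsilon>) * c (r k) x"
      using s(2)[of "r k"] r(2)[of k] by (auto simp: approximates_def)
    have "c (r k) x = c (r k) (t m)"
      using x(1) X t_min[of x k] by (auto simp: optimal_solution_iff intro: antisym)
    with x(2) show ?thesis by simp
  qed
  have "c' (t m) \<le> c' y" if "y \<in> X" for y
    by (rule LIMSEQ_le[OF lim_r[OF X(2)] lim_r[OF that]]) (use t_min[OF that] in blast)
  then have opt': "optimal_solution X c' (t m)"
    using X by (simp add: optimal_solution_iff)
  have "c' (s m) \<le> (1 + \<epsilon>) * c' (t m)"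
    by (rule LIMSEQ_le[OF lim_r[OF X(1)] tendsto_mult_left[OF lim_r[OF X(2)]]])
      (use s_appr in blast)
  with opt' X have "approximates \<epsilon> X c' (s m)"
    by (auto simp: approximates_def)
  with opt' s(1) t(1) show ?thesis by blast
qed

lemma row_prod_add: "row_prod a (l + l') = row_prod a l + row_prod a l'"
  by (simp add: row_prod_def algebra_simps sum.distrib)

lemma row_prod_scaleR: "row_prod a (r *\<^sub>R l) = r * row_prod a l"
  by (simp add: row_prod_def sum_distrib_left mult.left_commute)

lemma homogenization_add:
  "\<lbrakk>v \<in> homogenization \<I>; w \<in> homogenization \<I>\<rbrakk> \<Longrightarrow> v + w \<in> homogenization \<I>"
  by (auto simp: homogenization_def row_prod_add distrib_right add_mono)

lemma homogenization_scaleR: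
  "\<lbrakk>w \<in> homogenization \<I>; 0 \<le> r\<rbrakk> \<Longrightarrow> r *\<^sub>R w \<in> homogenization \<I>"
  by (auto simp: homogenization_def row_prod_scaleR mult.assoc mult_left_mono)

lemma homogenization_at_1: "(l, 1) \<in> homogenization \<I> \<longleftrightarrow> l \<in> param_set \<I>"
  by (simp add: homogenization_def param_set_def solution_set_def Ball_def)

lemma F_hom_at_1: "F_hom \<I> (l, 1) x = F \<I> l x"
  by (simp add: F_hom_def F_def inner_prod_def inner_vec_def)

text \<open>
  Multiplying the costs by the positive last component changes neither optimal nor approximating
  solutions.
\<close>

lemma hom_approximated_interior:
  assumes w: "(l, \<xi>) \<in> homogenization \<I>" and pos: "0 < \<xi>"
    and opt: "\<And>l. l \<in> param_set \<I> \<Longrightarrow> \<exists>x\<in>T. optimal_solution (feasible \<I>) (F \<I> l) x"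
    and appr: "\<And>l. l \<in> param_set \<I> \<Longrightarrow> \<exists>x\<in>S. approximates \<epsilon> (feasible \<I>) (F \<I> l) x"
  shows "(\<exists>x\<in>T. optimal_solution (feasible \<I>) (F_hom \<I> (l, \<xi>)) x) \<and>
    (\<exists>x\<in>S. approximates \<epsilon> (feasible \<I>) (F_hom \<I> (l, \<xi>)) x)"
proof -
  define l' where "l' = (1 / \<xi>) *\<^sub>R l"
  have w_eq: "(l, \<xi>) = \<xi> *\<^sub>R (l', 1)"
    using pos by (simp add: l'_def)
  have "(1 / \<xi>) *\<^sub>R (l, \<xi>) \<in> homogenization \<I>"
    using w pos by (intro homogenization_scaleR) auto
  then have l': "l' \<in> param_set \<I>"
    using pos by (simp add: l'_def homogenization_at_1)
  have "F_hom \<I> (l, \<xi>) x = \<xi> * F_hom \<I> (l', 1) x" for x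
    unfolding w_eq F_hom_def by (rule inner_scaleR_left)
  then have "F_hom \<I> (l, \<xi>) = (\<lambda>x. \<xi> * F \<I> l' x)"
    by (simp add: fun_eq_iff F_hom_at_1)
  with opt[OF l'] appr[OF l'] pos show ?thesis
    by (simp add: optimal_solution_scale approximates_scale)
qed

theorem theorem8:
  fixes \<P> :: "('p::finite, 'x) lp_problem"
    and q :: "nat poly"
    and \<I> :: "('p, 'x) lp_instance"
    and \<epsilon> :: real
    and S :: "'x set"
  assumes "linear_parametric_problem \<P>"
    and "assumption_a \<P> q"
    and "\<I> \<in> instances \<P>"
    and "assumption_b \<I>"
    and "\<epsilon> \<ge> 0"
    and "assumption_c \<epsilon> \<I>"
    and "S \<subseteq> X_pol \<P> q \<I>"
    and "approximation_set \<epsilon> \<I> S"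
  shows "\<forall>w \<in> homogenization \<I>.
           bounded_problem (feasible \<I>) (F_hom \<I> w) \<and>
           (\<exists>x\<in>S. approximates \<epsilon> (feasible \<I>) (F_hom \<I> w) x)"
proof
  fix w assume w: "w \<in> homogenization \<I>"
  let ?X = "feasible \<I>" and ?T = "X_pol \<P> q \<I>"
  have opt: "\<exists>x\<in>?T. optimal_solution ?X (F \<I> l) x" if "l \<in> param_set \<I>" for l
    using assms(2,3) that by (auto simp: assumption_a_def)
  have appr: "\<exists>x\<in>S. approximates \<epsilon> ?X (F \<I> l) x" if "l \<in> param_set \<I>" for l
    using assms(8) that by (auto simp: approximation_set_def)
  have "finite ?T"
    using assms(1,3) by (rule finite_X_pol)
  moreover from this have "finite S"
    using assms(7) by (rule rev_finite_subset)
  ultimately have fin: "finite S" "finite ?T" by blast+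
  \<comment> \<open>The empty set has affine dimension \<open>-1\<close>.\<close>
  have "param_set \<I> \<noteq> {}"
    using assms(4) by (auto simp: assumption_b_def)
  then obtain l\<^sub>0 where l0: "l\<^sub>0 \<in> param_set \<I>" by blast
  define v where "v n = w + inverse (real (Suc n)) *\<^sub>R (l\<^sub>0, 1)" for n
  have v_in: "v n \<in> homogenization \<I>" for n
    using w l0 unfolding v_def
    by (intro homogenization_add homogenization_scaleR) (auto simp: homogenization_at_1)
  have v_pos: "0 < snd (v n)" for n
    using w by (auto simp: v_def homogenization_def intro: add_nonneg_pos)
  have "v \<longlonglongrightarrow> w + 0 *\<^sub>R (l\<^sub>0, 1)"
    unfolding v_def by (intro tendsto_intros LIMSEQ_inverse_real_of_nat)
  then have "v \<longlonglongrightarrow> w"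
    by (simp only: scale_zero_left add_0_right)
  then have lim: "(\<lambda>n. F_hom \<I> (v n) x) \<longlonglongrightarrow> F_hom \<I> w x" for x
    unfolding F_hom_def by (intro tendsto_inner tendsto_const)
  have approximated: "(\<exists>x\<in>?T. optimal_solution ?X (F_hom \<I> (v n)) x) \<and>
      (\<exists>x\<in>S. approximates \<epsilon> ?X (F_hom \<I> (v n)) x)" for n
    using hom_approximated_interior[of "fst (v n)" "snd (v n)" \<I> ?T S \<epsilon>] v_in v_pos opt appr
    by simp
  have "(\<exists>x\<in>?T. optimal_solution ?X (F_hom \<I> w) x) \<and> (\<exists>x\<in>S. approximates \<epsilon> ?X (F_hom \<I> w) x)"
    by (rule approximates_limit[OF lim fin]) (use approximated in blast)+
  then show "bounded_problem ?X (F_hom \<I> w) \<and> (\<exists>x\<in>S. approximates \<epsilon> ?X (F_hom \<I> w) x)"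
    by (blast intro: optimal_solution_bounded)
qed

end
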